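(* There exist a Banach space $\mathcal{F}$, a $C_0$-semigroup $(e^{tL})_{t\ge0}$ in $\mathcal{F}$ with generator $(L,D(L))$, and a Chernoff function $G$ for the operator $(L,D(L))$ such that: 1. $\lim_{n\to\infty}\|G(t/n)^nf-e^{tL}f\|=0$ for all $f\in\mathcal{F}$ and all $t\ge0$; 2. $\|e^{tL}\|=\|G(t)\|=1$ for all $t\ge0$; 3. for each $t>0$ and each $n\in\mathbb{N}$, $n\ge1$, there exists $f_n\in\mathcal{F}$ such that $\|f_n\|=1$ and $\|G(t/n)^nf_n-e^{tL}f_n\|\ge\|f_n\|$; consequently $\|G(t/n)^n-e^{tL}\|\ge1$ for all $n$, so that $\|G(t/n)^n-e^{tL}\|\not\to0$ as $n\to\infty$.
   Context: Let $(e^{tL})_{t\ge0}$ be a $C_0$-semigroup with generator $L$ in a Banach space $\mathcal{F}$, and let $\mathscr{L}(\mathcal{F})$ be the space of bounded linear operators on $\mathcal{F}$. A mapping $S\colon[0,+\infty)\to\mathscr{L}(\mathcal{F})$ is called a Chernoff function for the operator $L$ iff for each $T>0$ and each $f\in\mathcal{F}$ one has $\lim_{n\to\infty}\sup_{t\in[0,T]}\|S(t/n)^nf-e^{tL}f\|=0$. *)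

theory Defs
  imports "HOL-Analysis.Analysis"
begin

text \<open>
  A theorem cannot quantify existentially over types, so a Banach space is not a type of class
  banach here but a pair of a carrier \<open>F\<close>, a linear subspace of an ambient real vector space
  \<open>'a\<close>, and a complete norm \<open>nrm\<close> on \<open>F\<close>.  No norm or topology of \<open>'a\<close> is used.
  Functions \<open>'a \<Rightarrow> 'a\<close> stand for operators on \<open>F\<close>; their values outside \<open>F\<close> are irrelevant.
\<close>

definition banach_space_on :: "'a::real_vector set \<Rightarrow> ('a \<Rightarrow> real) \<Rightarrow> bool" where
  "banach_space_on F nrm \<longleftrightarrow>
     subspace F \<and>
     (\<forall>x\<in>F. 0 \<le> nrm x) \<and>
     (\<forall>x\<in>F. nrm x = 0 \<longleftrightarrow> x = 0) \<and>
     (\<forall>x\<in>F. \<forall>y\<in>F. nrm (x + y) \<le> nrm x + nrm y) \<and>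
     (\<forall>c. \<forall>x\<in>F. nrm (c *\<^sub>R x) = \<bar>c\<bar> * nrm x) \<and>
     (\<forall>X :: nat \<Rightarrow> 'a. (\<forall>n. X n \<in> F) \<longrightarrow>
        (\<forall>e>0. \<exists>N. \<forall>m\<ge>N. \<forall>n\<ge>N. nrm (X m - X n) < e) \<longrightarrow>
        (\<exists>x\<in>F. (\<lambda>n. nrm (X n - x)) \<longlonglongrightarrow> 0))"

definition bounded_operator_on ::
    "'a::real_vector set \<Rightarrow> ('a \<Rightarrow> real) \<Rightarrow> ('a \<Rightarrow> 'a) \<Rightarrow> bool" where
  "bounded_operator_on F nrm A \<longleftrightarrow>
     (\<forall>x\<in>F. A x \<in> F) \<and>
     (\<forall>x\<in>F. \<forall>y\<in>F. A (x + y) = A x + A y) \<and>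
     (\<forall>c. \<forall>x\<in>F. A (c *\<^sub>R x) = c *\<^sub>R A x) \<and>
     (\<exists>K. \<forall>x\<in>F. nrm (A x) \<le> K * nrm x)"

definition operator_norm_on ::
    "'a::real_vector set \<Rightarrow> ('a \<Rightarrow> real) \<Rightarrow> ('a \<Rightarrow> 'a) \<Rightarrow> real" where
  "operator_norm_on F nrm A = (SUP x\<in>{x\<in>F. nrm x \<le> 1}. nrm (A x))"

definition C0_semigroup_on ::
    "'a::real_vector set \<Rightarrow> ('a \<Rightarrow> real) \<Rightarrow> (real \<Rightarrow> 'a \<Rightarrow> 'a) \<Rightarrow> bool" where
  "C0_semigroup_on F nrm E \<longleftrightarrow>
     (\<forall>t\<ge>0. bounded_operator_on F nrm (E t)) \<and>
     (\<forall>f\<in>F. E 0 f = f) \<and>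
     (\<forall>s\<ge>0. \<forall>t\<ge>0. \<forall>f\<in>F. E (s + t) f = E s (E t f)) \<and>
     (\<forall>f\<in>F. \<forall>t\<ge>0. ((\<lambda>s. nrm (E s f - E t f)) \<longlongrightarrow> 0) (at t within {0..}))"

definition has_generator_value ::
    "('a::real_vector \<Rightarrow> real) \<Rightarrow> (real \<Rightarrow> 'a \<Rightarrow> 'a) \<Rightarrow> 'a \<Rightarrow> 'a \<Rightarrow> bool" where
  "has_generator_value nrm E f g \<longleftrightarrow>
     ((\<lambda>h. nrm ((1 / h) *\<^sub>R (E h f - f) - g)) \<longlongrightarrow> 0) (at_right 0)"

text \<open>\<open>L\<close> is an unbounded operator with domain \<open>D\<close>; its values outside \<open>D\<close> are irrelevant.\<close>

definition is_generator_on ::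
    "'a::real_vector set \<Rightarrow> ('a \<Rightarrow> real) \<Rightarrow> (real \<Rightarrow> 'a \<Rightarrow> 'a) \<Rightarrow> 'a set \<Rightarrow> ('a \<Rightarrow> 'a) \<Rightarrow> bool" where
  "is_generator_on F nrm E D L \<longleftrightarrow>
     D = {f\<in>F. \<exists>g\<in>F. has_generator_value nrm E f g} \<and>
     (\<forall>f\<in>D. L f \<in> F \<and> has_generator_value nrm E f (L f))"

text \<open>
  \<open>S\<close> is a Chernoff function for the generator of the semigroup \<open>E\<close>.  The generator enters only
  through \<open>E\<close>, which it determines.  The supremum is taken in the extended reals, so that it is
  meaningful even when the set is not bounded.
\<close>

definition Chernoff_function_on ::
    "'a::real_vector set \<Rightarrow> ('a \<Rightarrow> real) \<Rightarrow> (real \<Rightarrow> 'a \<Rightarrow> 'a) \<Rightarrow> (real \<Rightarrow> 'a \<Rightarrow> 'a) \<Rightarrow> bool" where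
  "Chernoff_function_on F nrm E S \<longleftrightarrow>
     (\<forall>t\<ge>0. bounded_operator_on F nrm (S t)) \<and>
     (\<forall>T>0. \<forall>f\<in>F.
        (\<lambda>n::nat. SUP t\<in>{0..T}. ereal (nrm ((S (t / real n) ^^ n) f - E t f))) \<longlonglongrightarrow> 0)"

text \<open>
  The ambient space used in existence statements.  Only its real vector space structure matters:
  its algebraic dimension is that of the continuum, so every Banach space of at most that
  cardinality is isomorphic to some pair \<open>(F, nrm)\<close> over it.
\<close>

type_synonym ambient = "real \<Rightarrow>\<^sub>C real"

end

theory Submission
  imports Defs
begin

text \<open>
  On the bounded uniformly continuous functions on the real line let \<open>e\<^sup>t\<^sup>L\<close> be the translation by
  \<open>t\<close>, and let \<open>G(t)\<close> be the translation by \<open>t + t\<^sup>2\<close>.  Then \<open>G(t/n)\<^sup>n\<close> is the translation by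
  \<open>t + t\<^sup>2/n\<close>, which converges strongly, locally uniformly in \<open>t\<close>, by uniform continuity.  But
  \<open>x \<mapsto> cos (\<pi> n x / t\<^sup>2)\<close> changes its sign under the translation by \<open>t\<^sup>2/n\<close>, so the convergence
  is not in norm.
\<close>

section \<open>Translations of bounded uniformly continuous functions\<close>

definition buc :: "(real \<Rightarrow>\<^sub>C real) set" where
  "buc = {f. uniformly_continuous_on UNIV (apply_bcontfun f)}"

definition shift :: "real \<Rightarrow> (real \<Rightarrow>\<^sub>C real) \<Rightarrow> (real \<Rightarrow>\<^sub>C real)" where
  "shift t f = Bcontfun (\<lambda>x. f (x + t))"

text \<open>\<open>Bcontfun\<close> inverts evaluation only on bounded continuous functions, so the
  translate has to be shown to be one. Identities between translates then reduce to pointwise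
  ones.\<close>

lemma apply_shift [simp]: "shift t f x = f (x + t)"
proof -
  have "range (\<lambda>x. f (x + t)) \<subseteq> range f"
    by auto
  then have "bounded (range (\<lambda>x. f (x + t)))"
    using bounded_apply_bcontfun bounded_subset by blast
  moreover have "continuous_on UNIV (\<lambda>x. f (x + t))"
    by (rule continuous_on_compose2[of UNIV "apply_bcontfun f"]) (simp_all add: continuous_on_add)
  ultimately have "(\<lambda>x. f (x + t)) \<in> bcontfun"
    by (simp add: bcontfun_def)
  then show ?thesis
    by (simp add: shift_def Bcontfun_inverse)
qed

lemma shift_0: "shift 0 f = f"
  by (simp add: bcontfun_eqI)

lemma shift_shift: "shift s (shift t f) = shift (s + t) f"
  by (rule bcontfun_eqI) (simp add: add.assoc)

lemma shift_add: "shift t (f + g) = shift t f + shift t g"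
  by (rule bcontfun_eqI) simp

lemma shift_scaleR: "shift t (c *\<^sub>R f) = c *\<^sub>R shift t f"
  by (rule bcontfun_eqI) simp

lemma shift_funpow: "(shift s ^^ n) f = shift (real n * s) f"
  by (induction n) (simp_all add: shift_0 shift_shift algebra_simps)

lemma norm_shift: "norm (shift t f) = norm f"
proof (rule antisym)
  have le: "norm (shift s g) \<le> norm g" for s g
    using norm_bounded[of g] by (intro norm_bound) simp
  show "norm (shift t f) \<le> norm f"
    by (rule le)
  show "norm f \<le> norm (shift t f)"
    \<comment> \<open>The translation by \<open>- t\<close> undoes \<open>shift t\<close> and is a
      contraction too, so both are isometries.\<close>
    using le[of "- t" "shift t f"] by (simp add: shift_shift shift_0)
qed

lemma shift_in_buc:
  assumes "f \<in> buc"
  shows "shift t f \<in> buc"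
  unfolding buc_def mem_Collect_eq uniformly_continuous_on_def
proof (intro allI impI)
  fix e :: real
  assume "e > 0"
  then obtain d where "d > 0" and d: "\<And>x y. dist y x < d \<Longrightarrow> dist (f y) (f x) < e"
    using assms unfolding buc_def uniformly_continuous_on_def mem_Collect_eq
    by (metis UNIV_I)
  then show "\<exists>d>0. \<forall>x\<in>UNIV. \<forall>y\<in>UNIV. dist y x < d \<longrightarrow> dist (shift t f y) (shift t f x) < e"
    by (intro exI[of _ d]) simp
qed

text \<open>The modulus of continuity of \<open>f\<close> does not depend on the point, so it bounds
  the supremum norm. Strong continuity of the semigroup and the Chernoff convergence both rest on
  this estimate.\<close>

lemma shift_modulus:
  assumes "f \<in> buc" "e > 0"
  obtains d where "d > 0" "\<And>s t. \<bar>s - t\<bar> < d \<Longrightarrow> norm (shift s f - shift t f) < e"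
proof -
  \<comment> \<open>A pointwise strict bound gives only a weak bound on the supremum; halving
    \<open>e\<close> restores strictness.\<close>
  have "0 < e / 2"
    using assms(2) by simp
  then obtain d where "d > 0" and d: "\<And>x y. dist x y < d \<Longrightarrow> dist (f x) (f y) < e / 2"
    using assms(1) unfolding buc_def uniformly_continuous_on_def mem_Collect_eq
    by (metis UNIV_I)
  have "norm (shift s f - shift t f) \<le> e / 2" if "\<bar>s - t\<bar> < d" for s t
    using d that by (intro norm_bound) (force simp: dist_real_def less_imp_le)
  then show thesis
    using that[OF \<open>d > 0\<close>] assms(2) by fastforce
qed

section \<open>Completeness of the space\<close>

lemma subspace_buc: "subspace buc"
proof (rule subspaceI)
  show "0 \<in> buc"
    by (simp add: buc_def uniformly_continuous_on_const)
next
  fix f g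
  assume "f \<in> buc" "g \<in> buc"
  then have "uniformly_continuous_on UNIV (\<lambda>x. f x + g x)"
    unfolding buc_def mem_Collect_eq by (rule uniformly_continuous_on_add)
  then show "f + g \<in> buc"
    by (simp add: buc_def plus_bcontfun.rep_eq)
next
  fix c f
  assume "f \<in> buc"
  then have "uniformly_continuous_on UNIV (\<lambda>x. c *\<^sub>R f x)"
    unfolding buc_def mem_Collect_eq by (rule uniformly_continuous_on_cmul)
  then show "c *\<^sub>R f \<in> buc"
    by (simp add: buc_def scaleR_bcontfun.rep_eq)
qed

text \<open>Uniform limits preserve uniform continuity, by the usual three-term estimate through one
  close member of the sequence.\<close>

lemma closed_buc: "closed buc"
  unfolding closed_sequential_limits
proof (intro allI impI, elim conjE)
  fix X f
  assume X: "\<forall>n. X n \<in> buc" and lim: "X \<longlonglongrightarrow> f"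
  show "f \<in> buc"
    unfolding buc_def mem_Collect_eq uniformly_continuous_on_def
  proof (intro allI impI)
    fix e :: real
    assume "e > 0"
    then have e3: "e / 3 > 0"
      by simp
    then obtain n where n: "dist (X n) f < e / 3"
      using lim by (metis lim_sequentially order_refl)
    obtain d where "d > 0" and d: "\<And>x y. dist y x < d \<Longrightarrow> dist (X n y) (X n x) < e / 3"
      using X e3 unfolding buc_def uniformly_continuous_on_def mem_Collect_eq
      by (metis UNIV_I)
    have "dist (f y) (f x) < e" if "dist y x < d" for x y
      using d[OF that] dist_fun_lt_imp_dist_val_lt[OF n, of x] dist_fun_lt_imp_dist_val_lt[OF n, of y]
      unfolding dist_real_def by linarith
    then show "\<exists>d>0. \<forall>x\<in>UNIV. \<forall>y\<in>UNIV. dist y x < d \<longrightarrow> dist (f y) (f x) < e"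
      using \<open>d > 0\<close> by blast
  qed
qed

lemma banach_space_on_norm:
  fixes F :: "'a::{real_normed_vector, complete_space} set"
  assumes "subspace F" "closed F"
  shows "banach_space_on F norm"
proof -
  have "\<exists>x\<in>F. (\<lambda>n. norm (X n - x)) \<longlonglongrightarrow> 0"
    if X: "\<forall>n. X n \<in> F" and C: "\<forall>e>0. \<exists>N. \<forall>m\<ge>N. \<forall>n\<ge>N. norm (X m - X n) < e"
    for X :: "nat \<Rightarrow> 'a"
  proof -
    have "Cauchy X"
      using C by (intro CauchyI) blast
    then obtain x where x: "X \<longlonglongrightarrow> x"
      by (auto simp: Cauchy_convergent_iff convergent_def)
    then have "x \<in> F"
      using assms(2) X closed_sequentially by blast
    then show ?thesis
      using x by (auto simp: LIM_zero_iff tendsto_norm_zero_iff)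
  qed
  then show ?thesis
    using assms(1) by (simp add: banach_space_on_def norm_triangle_ineq)
qed

section \<open>Translations as a strongly continuous semigroup of norm 1\<close>

lemma bounded_operator_on_shift: "bounded_operator_on buc norm (shift t)"
  by (auto simp: bounded_operator_on_def shift_in_buc shift_add shift_scaleR norm_shift
      intro!: exI[of _ 1])

lemma const_bcontfun_in_buc: "const_bcontfun c \<in> buc"
  by (simp add: buc_def const_bcontfun.rep_eq uniformly_continuous_on_const)

lemma operator_norm_on_shift: "operator_norm_on buc norm (shift t) = 1"
proof -
  have one: "norm (const_bcontfun 1 :: real \<Rightarrow>\<^sub>C real) = 1"
  proof (rule antisym)
    show "norm (const_bcontfun 1 :: real \<Rightarrow>\<^sub>C real) \<le> 1"
      by (rule norm_bound) (simp add: const_bcontfun.rep_eq)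
    show "1 \<le> norm (const_bcontfun 1 :: real \<Rightarrow>\<^sub>C real)"
      using norm_bounded[of "const_bcontfun 1 :: real \<Rightarrow>\<^sub>C real" 0]
      by (simp add: const_bcontfun.rep_eq)
  qed
  show ?thesis
    unfolding operator_norm_on_def
  \<comment> \<open>By isometry no value exceeds 1, and the constant function 1 attains it.\<close>
  proof (rule cSup_eq_maximum)
    show "1 \<in> (\<lambda>f. norm (shift t f)) ` {f \<in> buc. norm f \<le> 1}"
      using one const_bcontfun_in_buc[of 1] by (auto simp: norm_shift intro!: image_eqI)
  qed (auto simp: norm_shift)
qed

lemma C0_semigroup_on_shift: "C0_semigroup_on buc norm shift"
proof -
  have "((\<lambda>s. norm (shift s f - shift t f)) \<longlongrightarrow> 0) (at t within {0..})" if f: "f \<in> buc" for f t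
  proof (rule tendstoI)
    fix e :: real
    assume "e > 0"
    then obtain d where "d > 0" and d: "\<And>s t. \<bar>s - t\<bar> < d \<Longrightarrow> norm (shift s f - shift t f) < e"
      using shift_modulus[OF f] by blast
    then show "\<forall>\<^sub>F s in at t within {0..}. dist (norm (shift s f - shift t f)) 0 < e"
      by (auto simp: eventually_at dist_real_def intro!: exI[of _ d])
  qed
  then show ?thesis
    by (simp add: C0_semigroup_on_def bounded_operator_on_shift shift_0 shift_shift)
qed

section \<open>Locally uniform strong convergence\<close>

lemma shift_square_funpow:
  assumes "n \<ge> 1"
  shows "(shift (t / real n + (t / real n)\<^sup>2) ^^ n) f = shift (t + t\<^sup>2 / real n) f"
proof -
  \<comment> \<open>For \<open>n = 0\<close> the iterate is the identity while the right-hand side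
    of the lemma is \<open>shift t f\<close>, so \<open>n \<ge> 1\<close> matters here.\<close>
  have "real n * (t / real n + (t / real n)\<^sup>2) = t + t\<^sup>2 / real n"
    using assms by (simp add: field_simps power2_eq_square)
  then show ?thesis
    by (simp add: shift_funpow)
qed

lemma shift_square_uniform:
  assumes f: "f \<in> buc" and e: "e > 0"
  shows "\<forall>\<^sub>F n in sequentially. \<forall>t\<in>{0..T}.
    norm ((shift (t / real n + (t / real n)\<^sup>2) ^^ n) f - shift t f) < e"
proof -
  obtain d where "d > 0" and d: "\<And>s t. \<bar>s - t\<bar> < d \<Longrightarrow> norm (shift s f - shift t f) < e"
    using shift_modulus[OF f e] by blast
  have "(\<lambda>n. T\<^sup>2 / real n) \<longlonglongrightarrow> 0"
    by (rule lim_const_over_n)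
  then have "\<forall>\<^sub>F n in sequentially. T\<^sup>2 / real n < d"
    using \<open>d > 0\<close> order_tendstoD(2) by blast
  then show ?thesis
    using eventually_ge_at_top[of 1]
  proof eventually_elim
    case (elim n)
    have "\<bar>(t + t\<^sup>2 / real n) - t\<bar> < d" if "t \<in> {0..T}" for t
    proof -
      \<comment> \<open>The excess translation is largest at \<open>t = T\<close>, so one threshold
        for \<open>n\<close> serves the whole interval.\<close>
      have "t\<^sup>2 / real n \<le> T\<^sup>2 / real n"
        using that by (intro divide_right_mono power_mono) auto
      then show ?thesis
        using elim by simp
    qed
    then show ?case
      using d elim by (simp only: shift_square_funpow) blast
  qed
qed

lemma Chernoff_function_on_shift_square:
  "Chernoff_function_on buc norm shift (\<lambda>t. shift (t + t\<^sup>2))"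
proof -
  have "(\<lambda>n. SUP t\<in>{0..T}. ereal (norm ((shift (t / real n + (t / real n)\<^sup>2) ^^ n) f - shift t f)))
      \<longlonglongrightarrow> 0" (is "?S \<longlonglongrightarrow> 0") if T: "T > 0" and f: "f \<in> buc" for T f
  proof -
    \<comment> \<open>The point 0 lies in the interval as \<open>T > 0\<close>; over an empty index
      set the extended real supremum would be minus infinity.\<close>
    have nonneg: "0 \<le> ?S n" for n
      using T by (intro SUP_upper2[of 0]) auto
    show ?thesis
    proof (rule order_tendstoI)
      fix a :: ereal
      assume "a < 0"
      then show "\<forall>\<^sub>F n in sequentially. a < ?S n"
        using nonneg by (intro always_eventually allI) (rule less_le_trans)
    next
      fix a :: ereal
      assume "0 < a"
      \<comment> \<open>A real strictly between 0 and \<open>a\<close> leaves room for the supremum,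
        which is bounded only weakly, and covers infinite \<open>a\<close>.\<close>
      then obtain e where e: "0 < ereal e" "ereal e < a"
        using ereal_dense2 by blast
      then have "0 < e"
        by simp
      from shift_square_uniform[OF f this, of T] show "\<forall>\<^sub>F n in sequentially. ?S n < a"
      proof eventually_elim
        case (elim n)
        then have "?S n \<le> ereal e"
          by (intro SUP_least) (simp add: less_imp_le)
        then show ?case
          using e(2) by (rule le_less_trans)
      qed
    qed
  qed
  then show ?thesis
    by (simp add: Chernoff_function_on_def bounded_operator_on_shift)
qed

lemma shift_square_tendsto:
  assumes f: "f \<in> buc" and "t \<ge> 0"
  shows "(\<lambda>n. norm ((shift (t / real n + (t / real n)\<^sup>2) ^^ n) f - shift t f)) \<longlonglongrightarrow> 0"
proof (rule tendstoI)
  fix e :: real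
  assume "e > 0"
  from shift_square_uniform[OF f this, of t]
  show "\<forall>\<^sub>F n in sequentially.
      dist (norm ((shift (t / real n + (t / real n)\<^sup>2) ^^ n) f - shift t f)) 0 < e"
    by eventually_elim (use \<open>t \<ge> 0\<close> in auto)
qed

section \<open>Failure of norm convergence\<close>

lemma exists_shift_sign_change:
  assumes "d > 0"
  shows "\<exists>f\<in>buc. norm f = 1 \<and> norm (shift (t + d) f - shift t f) \<ge> 2"
proof -
  \<comment> \<open>The frequency makes \<open>d\<close> half a period, so translating by
    \<open>d\<close> flips the sign.\<close>
  define f :: "real \<Rightarrow>\<^sub>C real" where "f = Bcontfun (\<lambda>x. cos (pi / d * x))"
  have "continuous_on UNIV (\<lambda>x. cos (pi / d * x))"
    by (intro continuous_on_cos continuous_on_mult continuous_on_const continuous_on_id)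
  then have "(\<lambda>x. cos (pi / d * x)) \<in> bcontfun"
    by (rule bcontfun_normI[where b = 1]) simp
  then have f: "f x = cos (pi / d * x)" for x
    by (simp add: f_def Bcontfun_inverse)
  have "(pi / d)-lipschitz_on UNIV (apply_bcontfun f)"
  proof (rule lipschitz_onI)
    fix x y
    have "\<bar>cos a - cos b\<bar> \<le> \<bar>a - b\<bar>" for a b :: real
    proof -
      \<comment> \<open>The cosine is 1-Lipschitz by the sum-to-product formula: one sine is at most
        1, the other at most its argument in absolute value.\<close>
      have "\<bar>cos a - cos b\<bar> = 2 * \<bar>sin ((a + b) / 2)\<bar> * \<bar>sin ((b - a) / 2)\<bar>"
        by (simp add: cos_diff_cos abs_mult)
      also have "\<dots> \<le> 2 * 1 * \<bar>(b - a) / 2\<bar>"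
        by (intro mult_mono abs_sin_x_le_abs_x) auto
      finally show ?thesis
        by simp
    qed
    then have "\<bar>f x - f y\<bar> \<le> \<bar>pi / d * x - pi / d * y\<bar>"
      unfolding f .
    also have "\<dots> = pi / d * \<bar>x - y\<bar>"
      using assms by (simp add: abs_mult flip: right_diff_distrib diff_divide_distrib)
    finally show "dist (f x) (f y) \<le> pi / d * dist x y"
      by (simp only: dist_real_def)
  qed (use assms in simp)
  then have "f \<in> buc"
    by (auto simp: buc_def intro: lipschitz_on_uniformly_continuous)
  moreover have "norm f = 1"
  proof (rule antisym)
    show "norm f \<le> 1"
      by (rule norm_bound) (simp add: f)
    show "1 \<le> norm f"
      using norm_bounded[of f 0] by (simp add: f)
  qed
  moreover have "norm (shift (t + d) f - shift t f) \<ge> 2"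
  proof -
    \<comment> \<open>At the point \<open>- t\<close> the two translates take the values
      \<open>cos pi = -1\<close> and \<open>cos 0 = 1\<close>.\<close>
    have "pi / d * (- t + (t + d)) = pi"
      using assms by simp
    then have "(shift (t + d) f - shift t f) (- t) = - 2"
      by (simp add: f)
    then show ?thesis
      using norm_bounded[of "shift (t + d) f - shift t f" "- t"] by simp
  qed
  ultimately show ?thesis
    by blast
qed

text \<open>The iterate overshoots \<open>shift t\<close> by \<open>t\<^sup>2 / real n\<close>.
  Taking this as the half period gives a unit vector, depending on \<open>n\<close>, on which the
  two operators differ by at least 2.\<close>

lemma exists_shift_square_far:
  assumes "t > 0" "n \<ge> 1"
  shows "\<exists>f\<in>buc. norm f = 1 \<and>
    norm ((shift (t / real n + (t / real n)\<^sup>2) ^^ n) f - shift t f) \<ge> norm f"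
proof -
  have "t\<^sup>2 / real n > 0"
    using assms by simp
  then obtain f where "f \<in> buc" "norm f = 1"
    "norm (shift (t + t\<^sup>2 / real n) f - shift t f) \<ge> 2"
    using exists_shift_sign_change by blast
  then show ?thesis
    using assms(2) by (intro bexI[of _ f]) (simp_all only: shift_square_funpow, simp_all)
qed

lemma operator_norm_on_shift_square_diff:
  assumes "t > 0" "n \<ge> 1"
  shows "operator_norm_on buc norm
    (\<lambda>f. (shift (t / real n + (t / real n)\<^sup>2) ^^ n) f - shift t f) \<ge> 1"
proof -
  obtain f where f: "f \<in> buc" "norm f = 1"
    "norm ((shift (t / real n + (t / real n)\<^sup>2) ^^ n) f - shift t f) \<ge> 1"
    using exists_shift_square_far[OF assms] by auto
  \<comment> \<open>The operator norm is a supremum of reals, so a lower bound from one vector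
    requires boundedness; two isometries differ by at most 2 on the unit ball.\<close>
  have "norm ((shift s ^^ n) g - shift t g) \<le> 2" if "norm g \<le> 1" for s g
    using norm_triangle_ineq4[of "(shift s ^^ n) g" "shift t g"] that
    by (simp add: norm_shift shift_funpow)
  then have "bdd_above ((\<lambda>g. norm ((shift (t / real n + (t / real n)\<^sup>2) ^^ n) g - shift t g))
      ` {g \<in> buc. norm g \<le> 1})"
    by (intro bdd_aboveI2[where M = 2]) auto
  then show ?thesis
    unfolding operator_norm_on_def using f by (intro cSUP_upper2) auto
qed

theorem proposition2p3:
  "\<exists>(F :: ambient set) (nrm :: ambient \<Rightarrow> real)
     (E :: real \<Rightarrow> ambient \<Rightarrow> ambient)
     (D :: ambient set) (L :: ambient \<Rightarrow> ambient)
     (G :: real \<Rightarrow> ambient \<Rightarrow> ambient).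
     banach_space_on F nrm \<and>
     C0_semigroup_on F nrm E \<and>
     is_generator_on F nrm E D L \<and>
     Chernoff_function_on F nrm E G \<and>
     (\<forall>f\<in>F. \<forall>t\<ge>0. (\<lambda>n::nat. nrm ((G (t / real n) ^^ n) f - E t f)) \<longlonglongrightarrow> 0) \<and>
     (\<forall>t\<ge>0. operator_norm_on F nrm (E t) = 1 \<and> operator_norm_on F nrm (G t) = 1) \<and>
     (\<forall>t>0. \<forall>n::nat. n \<ge> 1 \<longrightarrow>
        (\<exists>f\<in>F. nrm f = 1 \<and> nrm ((G (t / real n) ^^ n) f - E t f) \<ge> nrm f)) \<and>
     (\<forall>t>0. \<forall>n::nat. n \<ge> 1 \<longrightarrow>
        operator_norm_on F nrm (\<lambda>f. (G (t / real n) ^^ n) f - E t f) \<ge> 1) \<and>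
     (\<forall>t>0. \<not> (\<lambda>n::nat. operator_norm_on F nrm
                  (\<lambda>f. (G (t / real n) ^^ n) f - E t f)) \<longlonglongrightarrow> 0)"
proof -
  define D where "D = {f \<in> buc. \<exists>g\<in>buc. has_generator_value norm shift f g}"
  \<comment> \<open>On \<open>D\<close> a limit of the difference quotients exists, and choice
    selects it; the generator needs no explicit formula.\<close>
  define L where "L f = (SOME g. g \<in> buc \<and> has_generator_value norm shift f g)" for f
  have gen: "is_generator_on buc norm shift D L"
    unfolding is_generator_on_def
  proof (intro conjI ballI)
    fix f
    assume "f \<in> D"
    then have "\<exists>g. g \<in> buc \<and> has_generator_value norm shift f g"
      by (auto simp: D_def)
    then have "L f \<in> buc \<and> has_generator_value norm shift f (L f)"
      unfolding L_def by (rule someI_ex)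
    then show "L f \<in> buc" "has_generator_value norm shift f (L f)"
      by blast+
  qed (rule D_def)
  have "\<not> (\<lambda>n. operator_norm_on buc norm
      (\<lambda>f. (shift (t / real n + (t / real n)\<^sup>2) ^^ n) f - shift t f)) \<longlonglongrightarrow> 0" if "t > 0" for t
  proof
    assume "(\<lambda>n. operator_norm_on buc norm
      (\<lambda>f. (shift (t / real n + (t / real n)\<^sup>2) ^^ n) f - shift t f)) \<longlonglongrightarrow> 0"
    then have "(1::real) \<le> 0"
      \<comment> \<open>The lower bound 1 holds from \<open>n = 1\<close> on and passes to the
        limit.\<close>
      using operator_norm_on_shift_square_diff[OF that] by (intro LIMSEQ_le_const) blast+
    then show False
      by simp
  qed
  then show ?thesis
    using banach_space_on_norm[OF subspace_buc closed_buc] C0_semigroup_on_shift gen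
      Chernoff_function_on_shift_square shift_square_tendsto operator_norm_on_shift
      exists_shift_square_far operator_norm_on_shift_square_diff
    by (intro exI[of _ buc] exI[of _ norm] exI[of _ shift] exI[of _ D] exI[of _ L]
        exI[of _ "\<lambda>t. shift (t + t\<^sup>2)"] conjI) blast+
qed

end
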